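(* Let $u_1=\cos x$, and let $u_n(x)=\sum_{k=2}^n u_{n,k}\cos(kx)$ ($n\ge2$) and $v_n$ ($n\ge0$, $v_0=-1$) be the coefficients determined by the recurrence given in the context, and let $x^*\approx0.23$ be the number defined in the context. Then the power series $$u_\epsilon(x)=\sum_{n=1}^\infty u_n(x)\,\epsilon^n,\qquad v_\epsilon=\sum_{n=0}^\infty v_n\,\epsilon^n$$ converge (the first in $H^1(\mathbb T)$) for every $\epsilon$ with $|\epsilon|<x^*$.
   Context: The series is the formal expansion of the traveling waves $f(x,t)=u_\epsilon(x+v_\epsilon t)$ of the Burgers--Hilbert equation $f_t=Hf+ff_x$ on $\mathbb T=\mathbb R/2\pi\mathbb Z$, i.e. of solutions of $Hu_\epsilon-v_\epsilon u_\epsilon'+u_\epsilon u_\epsilon'=0$, where $\widehat{Hf}(k)=-i\,\mathrm{sgn}(k)\hat f(k)$. Recurrence: set $u_{1,1}=1$, $u_{n,1}=0$ for $n\ge2$, $v_0=-1$, and $u_{n,k}=0$ if $n-k$ is odd. For $n\ge2$, $$v_{n-1}=\frac12\sum_{m=1}^{n-1}\ \sum_{l=1}^{\min(m,\,n-m-1)}u_{m,l}\,u_{n-m,1+l},$$ and for $2\le k\le n$ with $k\equiv n \pmod 2$, $$(1-k)u_{n,k}+k\sum_{m=1}^{n-k}v_m u_{n-m,k}-\frac k4\sum_{m=1}^{n-1}\ \sum_{l=\max(1,k-n+m)}^{\min(m,k-1)}u_{m,l}u_{n-m,k-l}-\frac k2\sum_{m=1}^{n-1}\ \sum_{l=1}^{\min(m,\,n-m-k)}u_{m,l}u_{n-m,k+l}=0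 .$$ Empty sums are zero. Definition of $x^*$: with $B=\sqrt{\frac{\pi^2}{3}+\frac{869}{144}}$, $x^*$ is the largest $x>0$ satisfying $$8x+\sqrt{17}\,x^2-4\le-2\sqrt{(2Bx^2+4x)\left(x\sqrt{x^2+2.5}+2.5\,\sinh^{-1}(\sqrt{0.4}\,x)\right)} ;$$ numerically $x^*\approx0.23$. *)

theory Defs
  imports "HOL-Analysis.Analysis"
begin

text \<open>
  The recurrence for \<open>u\<^sub>n\<^sub>,\<^sub>k\<close> (\<open>1 \<le> k \<le> n\<close>) and \<open>v\<^sub>n\<close>. Only index pairs in this range occur,
  so values of \<open>u\<close> elsewhere are irrelevant. Index subtraction is truncated subtraction on
  naturals. This agrees with the integer bounds: \<open>n - m - k < 0\<close> gives an empty sum either way,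
  and \<open>k - n + m\<close> is written \<open>k + m - n\<close> under a maximum with 1.
\<close>

definition BH_coeffs :: "(nat \<Rightarrow> nat \<Rightarrow> real) \<Rightarrow> (nat \<Rightarrow> real) \<Rightarrow> bool" where
  "BH_coeffs u v \<longleftrightarrow>
     u 1 1 = 1 \<and> (\<forall>n\<ge>2. u n 1 = 0) \<and> v 0 = -1 \<and>
     (\<forall>n k. 1 \<le> k \<and> k \<le> n \<and> odd (n - k) \<longrightarrow> u n k = 0) \<and>
     (\<forall>n\<ge>2. v (n - 1) =
        1/2 * (\<Sum>m=1..n-1. \<Sum>l=1..min m (n-m-1). u m l * u (n-m) (1+l))) \<and>
     (\<forall>n k. 2 \<le> k \<and> k \<le> n \<and> even (n - k) \<longrightarrow>
        (1 - real k) * u n k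
        + real k * (\<Sum>m=1..n-k. v m * u (n-m) k)
        - real k / 4 * (\<Sum>m=1..n-1. \<Sum>l=max 1 (k+m-n)..min m (k-1). u m l * u (n-m) (k-l))
        - real k / 2 * (\<Sum>m=1..n-1. \<Sum>l=1..min m (n-m-k). u m l * u (n-m) (k+l)) = 0)"

definition BH_term :: "(nat \<Rightarrow> nat \<Rightarrow> real) \<Rightarrow> nat \<Rightarrow> real \<Rightarrow> real" where
  "BH_term u n x = (if n = 1 then cos x else (\<Sum>k=2..n. u n k * cos (real k * x)))"

definition xstar_B :: real where
  "xstar_B = sqrt (pi\<^sup>2 / 3 + 869 / 144)"

definition xstar :: real where
  "xstar = (GREATEST x. x > 0 \<and>
     8 * x + sqrt 17 * x\<^sup>2 - 4 \<le>
       - 2 * sqrt ((2 * xstar_B * x\<^sup>2 + 4 * x) *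
                   (x * sqrt (x\<^sup>2 + 2.5) + 2.5 * arsinh (sqrt 0.4 * x))))"

text \<open>
  The Sobolev space \<open>H\<^sup>1\<close> of the circle of length \<open>2\<pi>\<close>, via Fourier coefficients. Functions on
  the circle are \<open>2\<pi>\<close>-periodic functions on the line; functions equal almost everywhere are not
  identified, but \<open>fourier_coeff\<close>, and hence \<open>H1_norm\<close>, depends only on the class of \<open>f\<close>.
\<close>

definition fourier_coeff :: "(real \<Rightarrow> real) \<Rightarrow> int \<Rightarrow> complex" where
  "fourier_coeff f k =
     (1 / (2 * pi)) *\<^sub>R (LINT x:{0..2*pi}|lborel. complex_of_real (f x) * cis (- (real_of_int k * x)))"

definition L2_torus :: "(real \<Rightarrow> real) set" where
  "L2_torus = {f. (\<forall>x. f (x + 2 * pi) = f x) \<and> f \<in> borel_measurable borel \<and>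
                  set_integrable lborel {0..2*pi} (\<lambda>x. (f x)\<^sup>2)}"

definition H1_torus :: "(real \<Rightarrow> real) set" where
  "H1_torus = {f \<in> L2_torus.
     (\<lambda>k. (1 + (real_of_int k)\<^sup>2) * (cmod (fourier_coeff f k))\<^sup>2) summable_on UNIV}"

text \<open>Meaningful only on \<^const>\<open>H1_torus\<close>, since \<^const>\<open>infsum\<close> is 0 on non-summable families.\<close>

definition H1_norm :: "(real \<Rightarrow> real) \<Rightarrow> real" where
  "H1_norm f = sqrt (\<Sum>\<^sub>\<infinity>k. (1 + (real_of_int k)\<^sup>2) * (cmod (fourier_coeff f k))\<^sup>2)"

definition H1_tendsto :: "(nat \<Rightarrow> real \<Rightarrow> real) \<Rightarrow> (real \<Rightarrow> real) \<Rightarrow> bool" where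
  "H1_tendsto F f \<longleftrightarrow>
     (\<forall>N. F N \<in> H1_torus) \<and> f \<in> H1_torus \<and> (\<lambda>N. H1_norm (\<lambda>x. F N x - f x)) \<longlonglongrightarrow> 0"

end

theory Submission
  imports Defs
begin

text \<open>
  Put \<open>R = 6/25\<close>, \<open>t\<^sub>n = R\<^sup>n (\<bar>u\<^sub>n\<^sub>,\<^sub>1\<bar> + \<dots> + \<bar>u\<^sub>n\<^sub>,\<^sub>n\<bar>)\<close> and \<open>y\<^sub>n = R\<^sup>n \<bar>v\<^sub>n\<bar>\<close>. Since \<open>k / (k - 1) \<le> 2\<close> for
  \<open>k \<ge> 2\<close>, the recurrence bounds \<open>t\<^sub>n\<close> and \<open>y\<^sub>n\<^sub>-\<^sub>1\<close> by convolutions of \<open>t\<close> and \<open>y\<close> with indices below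
  \<open>n\<close>, so the partial sums \<open>W\<close> of \<open>t\<^sub>n\<close>, \<open>n \<ge> 2\<close>, satisfy a cubic inequality that confines
  them to \<open>W \<le> 11/100\<close> by induction. Hence \<open>t\<close> and \<open>y\<close> are bounded, whereas \<open>xstar < R\<close> by crude
  estimates, so both series converge geometrically for \<open>\<bar>\<epsilon>\<bar> < xstar\<close>. As \<open>u\<^sub>n\<close> has degree at most
  \<open>n\<close>, the Fourier coefficients of the sum decay geometrically too, which gives convergence in
  \<open>H\<^sup>1\<close> although \<open>t\<close> only controls an \<open>\<ell>\<^sup>1\<close> norm.
\<close>

section \<open>Convolution sums\<close>

text \<open>The index changes below are injective but not always onto, so nonnegativity is what
  turns reindexing into an upper bound.\<close>

lemma sum_inj_le:
  fixes g :: "'b \<Rightarrow> real"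
  assumes "inj_on h A" "h ` A \<subseteq> B" "finite B" "\<And>b. b \<in> B \<Longrightarrow> 0 \<le> g b"
  shows "(\<Sum>a\<in>A. g (h a)) \<le> sum g B"
proof -
  have "(\<Sum>a\<in>A. g (h a)) = sum g (h ` A)"
    using assms(1) by (simp add: sum.reindex)
  also have "\<dots> \<le> sum g B"
    using assms by (intro sum_mono2) auto
  finally show ?thesis .
qed

text \<open>The map from \<open>(n, m)\<close> to \<open>(m, n - m)\<close> sends the triangle
  injectively into a square. The shift from \<open>Suc N\<close> to \<open>N\<close> is what later
  lets partial sums up to \<open>N\<close> control the next one.\<close>

lemma convolution_partial_sum_le:
  fixes f g :: "nat \<Rightarrow> real"
  assumes "\<And>n. 0 \<le> f n" "\<And>n. 0 \<le> g n"
  shows "(\<Sum>n=2..Suc N. \<Sum>m=1..n-1. f m * g (n-m)) \<le> (\<Sum>m=1..N. f m) * (\<Sum>m=1..N. g m)"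
proof -
  have "(\<Sum>n=2..Suc N. \<Sum>m=1..n-1. f m * g (n-m))
      = (\<Sum>p\<in>(SIGMA n:{2..Suc N}. {1..n-1}).
          case (snd p, fst p - snd p) of (i, j) \<Rightarrow> f i * g j)"
    by (subst sum.Sigma) (auto simp: case_prod_beta)
  also have "\<dots> \<le> (\<Sum>(i, j)\<in>{1..N}\<times>{1..N}. f i * g j)"
    using assms by (intro sum_inj_le[where g = "\<lambda>(i, j). f i * g j"]) (auto simp: inj_on_def)
  finally show ?thesis
    by (simp add: sum_product sum.cartesian_product)
qed

text \<open>With \<open>i = l\<close> and \<open>j = k - l\<close>, the bounds on \<open>l\<close>
  say exactly \<open>1 \<le> i \<le> m\<close> and \<open>1 \<le> j \<le> n - m\<close>.\<close>

lemma sum_index_add_le: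
  fixes f g :: "nat \<Rightarrow> real"
  assumes "\<And>i. 0 \<le> f i" "\<And>i. 0 \<le> g i" "m \<le> n"
  shows "(\<Sum>k=2..n. \<Sum>l=max 1 (k+m-n)..min m (k-1). f l * g (k-l))
      \<le> (\<Sum>i=1..m. f i) * (\<Sum>j=1..n-m. g j)"
proof -
  have "(\<Sum>k=2..n. \<Sum>l=max 1 (k+m-n)..min m (k-1). f l * g (k-l))
      = (\<Sum>p\<in>(SIGMA k:{2..n}. {max 1 (k+m-n)..min m (k-1)}).
          case (snd p, fst p - snd p) of (i, j) \<Rightarrow> f i * g j)"
    by (subst sum.Sigma) (auto simp: case_prod_beta)
  also have "\<dots> \<le> (\<Sum>(i, j)\<in>{1..m}\<times>{1..n-m}. f i * g j)"
    using assms by (intro sum_inj_le[where g = "\<lambda>(i, j). f i * g j"]) (auto simp: inj_on_def)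
  finally show ?thesis
    by (simp add: sum_product sum.cartesian_product)
qed

text \<open>Here \<open>i = l\<close> and \<open>j = k + l\<close>, and \<open>0 \<notin> K\<close>
  forces \<open>i < j\<close>. Keeping this restriction allows a symmetry argument to halve the
  bound. \<open>K\<close> will be \<open>{1}\<close> for the speeds and \<open>{2..n}\<close> for
  the modes.\<close>

lemma sum_index_diff_le:
  fixes f g :: "nat \<Rightarrow> real"
  assumes "\<And>i. 0 \<le> f i" "\<And>i. 0 \<le> g i" "finite K" "0 \<notin> K"
  shows "(\<Sum>k\<in>K. \<Sum>l=1..min m (n-m-k). f l * g (k+l))
      \<le> (\<Sum>(i, j)\<in>{(i, j) \<in> {1..m}\<times>{1..n-m}. i < j}. f i * g j)"
proof -
  have "(\<Sum>k\<in>K. \<Sum>l=1..min m (n-m-k). f l * g (k+l))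
      = (\<Sum>p\<in>(SIGMA k:K. {1..min m (n-m-k)}).
          case (snd p, fst p + snd p) of (i, j) \<Rightarrow> f i * g j)"
    using assms(3) by (subst sum.Sigma) (auto simp: case_prod_beta)
  also have "\<dots> \<le> (\<Sum>(i, j)\<in>{(i, j) \<in> {1..m}\<times>{1..n-m}. i < j}. f i * g j)"
    using assms by (intro sum_inj_le[where g = "\<lambda>(i, j). f i * g j"])
      (auto simp: inj_on_def intro: gr0I intro!: finite_subset[OF _ finite_cartesian_product[of "{1..m}" "{1..n-m}"]])
  finally show ?thesis .
qed

text \<open>The swap \<open>(m, i, j) \<mapsto> (n - m, j, i)\<close> exchanges the parts \<open>i < j\<close> and \<open>j < i\<close>.\<close>

lemma sum_less_pairs_le:
  fixes a :: "nat \<Rightarrow> nat \<Rightarrow> real"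
  assumes "\<And>m i. 0 \<le> a m i" and "n \<ge> 2"
  shows "2 * (\<Sum>m=1..n-1. \<Sum>(i, j)\<in>{(i, j) \<in> {1..m}\<times>{1..n-m}. i < j}. a m i * a (n-m) j)
      \<le> (\<Sum>m=1..n-1. (\<Sum>i=1..m. a m i) * (\<Sum>j=1..n-m. a (n-m) j))
         - (if n = 2 then (a 1 1)\<^sup>2 else 0)"
proof -
  define L where "L m = (\<Sum>(i, j)\<in>{(i, j) \<in> {1..m}\<times>{1..n-m}. i < j}. a m i * a (n-m) j)" for m
  define G where "G m = (\<Sum>(i, j)\<in>{(i, j) \<in> {1..m}\<times>{1..n-m}. j < i}. a m i * a (n-m) j)" for m
  define D where "D m = (\<Sum>(i, j)\<in>{(i, j) \<in> {1..m}\<times>{1..n-m}. i = j}. a m i * a (n-m) j)" for m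
  have split: "(\<Sum>i=1..m. a m i) * (\<Sum>j=1..n-m. a (n-m) j) = L m + G m + D m" for m
  proof -
    let ?X = "{1..m}\<times>{1..n-m}"
    have X: "?X = {(i, j) \<in> ?X. i < j} \<union> {(i, j) \<in> ?X. j < i} \<union> {(i, j) \<in> ?X. i = j}"
      by auto
    have "(\<Sum>(i, j)\<in>?X. a m i * a (n-m) j)
      = (\<Sum>(i, j)\<in>{(i, j) \<in> ?X. i < j} \<union> {(i, j) \<in> ?X. j < i} \<union> {(i, j) \<in> ?X. i = j}. a m i * a (n-m) j)"
      by (intro sum.cong refl X)
    also have "\<dots> = L m + G m + D m"
      unfolding L_def G_def D_def
      by (subst sum.union_disjoint; (subst sum.union_disjoint)?) (auto intro: finite_subset[of _ ?X])
    finally show ?thesis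
      by (simp add: sum_product sum.cartesian_product)
  qed
  have "L m = G (n-m)" if "m \<in> {1..n-1}" for m
    unfolding L_def G_def using that
    by (intro sum.reindex_bij_witness[of _ prod.swap prod.swap]) (auto simp: mult.commute)
  then have "(\<Sum>m=1..n-1. L m) = (\<Sum>m=1..n-1. G m)"
    by (intro sum.reindex_bij_witness[of _ "\<lambda>m. n-m" "\<lambda>m. n-m"]) auto
  \<comment> \<open>For \<open>n = 2\<close> the diagonal is the single entry
    \<open>(a 1 1)\<^sup>2\<close>. It is kept because it later cancels the square of row 1 in the
    speed bound; for other \<open>n\<close> nonnegativity is enough.\<close>
  moreover have "(\<Sum>m=1..n-1. D m) \<ge> (if n = 2 then (a 1 1)\<^sup>2 else 0)"
  proof (cases "n = 2")
    case True
    then have "{(i, j) \<in> {1..1}\<times>{1..n-1}. i = j} = {(1, 1)}"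
      by auto
    then have "D 1 = (a 1 1)\<^sup>2"
      using True unfolding D_def by (simp only:) (simp add: power2_eq_square)
    then show ?thesis using True by simp
  next
    case False
    then show ?thesis
      using assms(1) by (auto simp: D_def intro!: sum_nonneg)
  qed
  ultimately show ?thesis
    unfolding split sum.distrib L_def[symmetric] by linarith
qed

section \<open>Majorants for the coefficients\<close>

text \<open>Solving the recurrence for \<open>u n k\<close> divides by \<open>k - 1\<close>, and
  \<open>k \<le> 2 * (k - 1)\<close> turns the factors \<open>k\<close>, \<open>k / 4\<close>,
  \<open>k / 2\<close> into 2, 1/2, 1. All products have total row index \<open>n\<close>, so the
  weight \<open>x ^ n\<close> distributes over their factors.\<close>

lemma BH_mode_le:
  assumes "BH_coeffs u v" "x \<ge> 0" "2 \<le> k" "k \<le> n"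
  defines "a \<equiv> \<lambda>m i. x ^ m * \<bar>u m i\<bar>"
  shows "a n k \<le> 2 * (\<Sum>m=1..n-k. x ^ m * \<bar>v m\<bar> * a (n-m) k)
    + 1/2 * (\<Sum>m=1..n-1. \<Sum>l=max 1 (k+m-n)..min m (k-1). a m l * a (n-m) (k-l))
    + (\<Sum>m=1..n-1. \<Sum>l=1..min m (n-m-k). a m l * a (n-m) (k+l))"
    (is "_ \<le> 2 * ?A + 1/2 * ?B + ?C")
proof -
  have nonneg: "?A \<ge> 0" "?B \<ge> 0" "?C \<ge> 0"
    using assms(2) by (auto simp: a_def intro!: sum_nonneg)
  show ?thesis
  proof (cases "even (n-k)")
    case False
    then have "a n k = 0"
      using assms unfolding BH_coeffs_def by auto
    then show ?thesis using nonneg by simp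
  next
    case True
    define A where "A = (\<Sum>m=1..n-k. v m * u (n-m) k)"
    define B where "B = (\<Sum>m=1..n-1. \<Sum>l=max 1 (k+m-n)..min m (k-1). u m l * u (n-m) (k-l))"
    define C where "C = (\<Sum>m=1..n-1. \<Sum>l=1..min m (n-m-k). u m l * u (n-m) (k+l))"
    have eq: "(1 - real k) * u n k + real k * A - real k / 4 * B - real k / 2 * C = 0"
      using assms(1,3,4) True unfolding BH_coeffs_def A_def B_def C_def by blast
    have p: "x ^ m * x ^ (n-m) = x ^ n" if "m \<le> n" for m
      using that by (simp flip: power_add)
    have A: "x ^ n * \<bar>A\<bar> \<le> ?A"
    proof -
      have "x ^ n * \<bar>A\<bar> \<le> x ^ n * (\<Sum>m=1..n-k. \<bar>v m * u (n-m) k\<bar>)"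
        unfolding A_def using assms(2) by (intro mult_left_mono sum_abs) auto
      also have "\<dots> = ?A"
        unfolding sum_distrib_left a_def
        by (intro sum.cong refl) (auto simp: abs_mult simp flip: p)
      finally show ?thesis .
    qed
    have B: "x ^ n * \<bar>B\<bar> \<le> ?B"
    proof -
      have "x ^ n * \<bar>B\<bar> \<le> x ^ n * (\<Sum>m=1..n-1. \<Sum>l=max 1 (k+m-n)..min m (k-1). \<bar>u m l * u (n-m) (k-l)\<bar>)"
        unfolding B_def using assms(2)
        by (intro mult_left_mono order_trans[OF sum_abs] sum_mono sum_abs) auto
      also have "\<dots> = ?B"
        unfolding sum_distrib_left a_def
        by (intro sum.cong refl) (auto simp: abs_mult simp flip: p)
      finally show ?thesis .
    qed
    have C: "x ^ n * \<bar>C\<bar> \<le> ?C"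
    proof -
      have "x ^ n * \<bar>C\<bar> \<le> x ^ n * (\<Sum>m=1..n-1. \<Sum>l=1..min m (n-m-k). \<bar>u m l * u (n-m) (k+l)\<bar>)"
        unfolding C_def using assms(2)
        by (intro mult_left_mono order_trans[OF sum_abs] sum_mono sum_abs) auto
      also have "\<dots> = ?C"
        unfolding sum_distrib_left a_def
        by (intro sum.cong refl) (auto simp: abs_mult simp flip: p)
      finally show ?thesis .
    qed
    define S where "S = \<bar>A\<bar> + \<bar>B\<bar>/4 + \<bar>C\<bar>/2"
    have "(real k - 1) * \<bar>u n k\<bar> = \<bar>(real k - 1) * u n k\<bar>"
      using assms(3) by (simp add: abs_mult)
    also have "(real k - 1) * u n k = real k * (A - B/4 - C/2)"
      using eq by (simp add: algebra_simps)
    also have "\<bar>\<dots>\<bar> \<le> real k * S"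
      unfolding abs_mult S_def by (intro mult_mono) auto
    also have "\<dots> \<le> (2 * (real k - 1)) * S"
      using assms(3) by (intro mult_right_mono) (auto simp: S_def)
    finally have "(real k - 1) * \<bar>u n k\<bar> \<le> (real k - 1) * (2 * S)"
      by (simp add: mult_ac)
    then have "\<bar>u n k\<bar> \<le> 2 * S"
      using assms(3) by simp
    then have "a n k \<le> x ^ n * (2 * S)"
      unfolding a_def using assms(2) by (intro mult_left_mono) auto
    also have "\<dots> = 2 * (x ^ n * \<bar>A\<bar>) + 1/2 * (x ^ n * \<bar>B\<bar>) + x ^ n * \<bar>C\<bar>"
      by (simp add: S_def algebra_simps)
    also have "\<dots> \<le> 2 * ?A + 1/2 * ?B + ?C"
      using A B C by linarith
    finally show ?thesis .
  qed
qed

text \<open>The products defining \<open>v (n-1)\<close> have total row index \<open>n\<close>, one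
  more than the index of the speed; hence the extra factor \<open>x\<close>.\<close>

lemma BH_speed_le:
  assumes "BH_coeffs u v" "x \<ge> 0" "n \<ge> 2"
  defines "a \<equiv> \<lambda>m i. x ^ m * \<bar>u m i\<bar>"
  shows "x * (x ^ (n-1) * \<bar>v (n-1)\<bar>)
    \<le> 1/2 * (\<Sum>m=1..n-1. \<Sum>l=1..min m (n-m-1). a m l * a (n-m) (1+l))"
proof -
  have p: "x ^ m * x ^ (n-m) = x ^ n" if "m \<le> n" for m
    using that by (simp flip: power_add)
  have v: "v (n-1) = 1/2 * (\<Sum>m=1..n-1. \<Sum>l=1..min m (n-m-1). u m l * u (n-m) (1+l))"
    using assms(1,3) unfolding BH_coeffs_def by blast
  have "x * (x ^ (n-1) * \<bar>v (n-1)\<bar>) = x ^ n * \<bar>v (n-1)\<bar>"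
    using assms(3) by (simp add: power_eq_if)
  also have "\<dots> = 1/2 * (x ^ n * \<bar>\<Sum>m=1..n-1. \<Sum>l=1..min m (n-m-1). u m l * u (n-m) (1+l)\<bar>)"
    unfolding v by (simp add: abs_mult)
  also have "\<dots> \<le> 1/2 * (x ^ n * (\<Sum>m=1..n-1. \<Sum>l=1..min m (n-m-1). \<bar>u m l * u (n-m) (1+l)\<bar>))"
    using assms(2)
    by (intro mult_left_mono order_trans[OF sum_abs] sum_mono sum_abs) auto
  also have "\<dots> = 1/2 * (\<Sum>m=1..n-1. \<Sum>l=1..min m (n-m-1). a m l * a (n-m) (1+l))"
    unfolding sum_distrib_left a_def
    by (intro sum.cong refl) (auto simp: abs_mult simp flip: p)
  finally show ?thesis .
qed


section \<open>Weighted row sums\<close>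

text \<open>A weighted l^1 norm of the cosine coefficients of the \<open>n\<close>-th term: it
  dominates the sup norm, and convolutions of coefficients are bounded by products of such
  norms.\<close>

definition row_mass :: "(nat \<Rightarrow> nat \<Rightarrow> real) \<Rightarrow> real \<Rightarrow> nat \<Rightarrow> real" where
  "row_mass u x n = (\<Sum>k=1..n. x ^ n * \<bar>u n k\<bar>)"

lemma row_mass_nonneg: "x \<ge> 0 \<Longrightarrow> row_mass u x n \<ge> 0"
  unfolding row_mass_def by (intro sum_nonneg) auto

lemma BH_row_mass_1: "BH_coeffs u v \<Longrightarrow> row_mass u x 1 = x"
  unfolding row_mass_def BH_coeffs_def by simp

lemma BH_row_mass_drop_1:
  assumes "BH_coeffs u v" "n \<ge> 2"
  shows "row_mass u x n = (\<Sum>k=2..n. x ^ n * \<bar>u n k\<bar>)"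
proof -
  have "u n 1 = 0" using assms unfolding BH_coeffs_def by blast
  moreover have "{1..n} = insert 1 {2..n}" using assms(2) by auto
  ultimately show ?thesis unfolding row_mass_def by simp
qed

text \<open>The pairs with \<open>j = i + 1\<close> are enlarged to all pairs \<open>i < j\<close>,
  which symmetry bounds by half of the full convolution. With the factor 1/2 of the recurrence this
  gives the 4 on the left.\<close>

lemma BH_speed_le_row_mass:
  assumes "BH_coeffs u v" "x \<ge> 0" "n \<ge> 2"
  defines "t \<equiv> row_mass u x"
  shows "4 * x * (x ^ (n-1) * \<bar>v (n-1)\<bar>)
    \<le> (\<Sum>m=1..n-1. t m * t (n-m)) - (if n = 2 then x\<^sup>2 else 0)"
proof -
  define a where "a = (\<lambda>m i. x ^ m * \<bar>u m i\<bar>)"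
  have a: "a m i \<ge> 0" for m i
    using assms(2) by (simp add: a_def)
  have "x * (x ^ (n-1) * \<bar>v (n-1)\<bar>)
    \<le> 1/2 * (\<Sum>m=1..n-1. \<Sum>l=1..min m (n-m-1). a m l * a (n-m) (1+l))"
    using BH_speed_le[OF assms(1-3)] by (simp add: a_def)
  also have "\<dots> \<le> 1/2 * (\<Sum>m=1..n-1. \<Sum>(i, j)\<in>{(i, j) \<in> {1..m}\<times>{1..n-m}. i < j}. a m i * a (n-m) j)"
    using sum_index_diff_le[of "a m" "a (n-m)" "{1}" for m] a
    by (intro mult_left_mono sum_mono) auto
  finally have "4 * x * (x ^ (n-1) * \<bar>v (n-1)\<bar>)
    \<le> 2 * (\<Sum>m=1..n-1. \<Sum>(i, j)\<in>{(i, j) \<in> {1..m}\<times>{1..n-m}. i < j}. a m i * a (n-m) j)"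
    unfolding mult.assoc by linarith
  also note sum_less_pairs_le[of a, OF a assms(3)]
  also have "a 1 1 = x"
    using assms(1) by (simp add: a_def BH_coeffs_def)
  finally show ?thesis
    unfolding t_def row_mass_def a_def .
qed

text \<open>When the mode bounds are summed over \<open>k\<close>, the pairs
  \<open>(l, k - l)\<close> contribute half of the full convolution. The pairs
  \<open>(l, k + l)\<close> satisfy \<open>i < j\<close> and contribute at most another half, less
  half the diagonal when \<open>n = 2\<close>.\<close>

lemma BH_row_mass_le:
  assumes "BH_coeffs u v" "x \<ge> 0" "n \<ge> 2"
  defines "t \<equiv> row_mass u x"
  shows "t n \<le> 2 * (\<Sum>m=1..n-1. x ^ m * \<bar>v m\<bar> * (if n - m \<ge> 2 then t (n-m) else 0))
    + (\<Sum>m=1..n-1. t m * t (n-m)) - (if n = 2 then x\<^sup>2 / 2 else 0)"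
proof -
  define a where "a = (\<lambda>m i. x ^ m * \<bar>u m i\<bar>)"
  have a: "a m i \<ge> 0" for m i
    using assms(2) by (simp add: a_def)
  have t: "t n = (\<Sum>k=1..n. a n k)" for n
    by (simp add: t_def row_mass_def a_def)
  let ?A = "\<Sum>k=2..n. \<Sum>m=1..n-k. x ^ m * \<bar>v m\<bar> * a (n-m) k"
  let ?B = "\<Sum>k=2..n. \<Sum>m=1..n-1. \<Sum>l=max 1 (k+m-n)..min m (k-1). a m l * a (n-m) (k-l)"
  let ?C = "\<Sum>k=2..n. \<Sum>m=1..n-1. \<Sum>l=1..min m (n-m-k). a m l * a (n-m) (k+l)"
  have "t n = (\<Sum>k=2..n. a n k)"
    using BH_row_mass_drop_1[OF assms(1,3)] by (simp add: t_def a_def)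
  also have "\<dots> \<le> (\<Sum>k=2..n. 2 * (\<Sum>m=1..n-k. x ^ m * \<bar>v m\<bar> * a (n-m) k)
    + 1/2 * (\<Sum>m=1..n-1. \<Sum>l=max 1 (k+m-n)..min m (k-1). a m l * a (n-m) (k-l))
    + (\<Sum>m=1..n-1. \<Sum>l=1..min m (n-m-k). a m l * a (n-m) (k+l)))"
    unfolding a_def using assms(1,2) by (intro sum_mono BH_mode_le) auto
  also have "\<dots> = 2 * ?A + 1/2 * ?B + ?C"
    by (simp only: sum.distrib sum_distrib_left)
  finally have main: "t n \<le> 2 * ?A + 1/2 * ?B + ?C" .
  have "?A = (\<Sum>m=1..n-1. \<Sum>k=2..n-m. x ^ m * \<bar>v m\<bar> * a (n-m) k)"
  proof -
    have "?A = (\<Sum>(k, m)\<in>(SIGMA k:{2..n}. {1..n-k}). x ^ m * \<bar>v m\<bar> * a (n-m) k)"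
      by (rule sum.Sigma) auto
    also have "\<dots> = (\<Sum>(m, k)\<in>(SIGMA m:{1..n-1}. {2..n-m}). x ^ m * \<bar>v m\<bar> * a (n-m) k)"
      by (intro sum.reindex_bij_witness[of _ prod.swap prod.swap]) auto
    finally show ?thesis
      by (subst sum.Sigma) auto
  qed
  \<comment> \<open>Only modes \<open>k \<ge> 2\<close> occur, so row 1 drops out; keeping it would
    add a term \<open>2 * x * Y N\<close> to the later inequality for \<open>W\<close>.\<close>
  also have "\<dots> \<le> (\<Sum>m=1..n-1. x ^ m * \<bar>v m\<bar> * (if n - m \<ge> 2 then t (n-m) else 0))"
  proof (intro sum_mono)
    fix m
    have "(\<Sum>k=2..n-m. a (n-m) k) \<le> t (n-m)" if "n - m \<ge> 2"
      unfolding t using a by (intro sum_mono2) auto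
    then show "(\<Sum>k=2..n-m. x ^ m * \<bar>v m\<bar> * a (n-m) k)
        \<le> x ^ m * \<bar>v m\<bar> * (if n - m \<ge> 2 then t (n-m) else 0)"
      using assms(2) by (simp add: mult_left_mono flip: sum_distrib_left)
  qed
  finally have A: "?A \<le> (\<Sum>m=1..n-1. x ^ m * \<bar>v m\<bar> * (if n - m \<ge> 2 then t (n-m) else 0))" .
  have "?B = (\<Sum>m=1..n-1. \<Sum>k=2..n. \<Sum>l=max 1 (k+m-n)..min m (k-1). a m l * a (n-m) (k-l))"
    by (rule sum.swap)
  also have "\<dots> \<le> (\<Sum>m=1..n-1. t m * t (n-m))"
    unfolding t using a by (intro sum_mono sum_index_add_le) auto
  finally have B: "?B \<le> (\<Sum>m=1..n-1. t m * t (n-m))" .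
  have "?C = (\<Sum>m=1..n-1. \<Sum>k=2..n. \<Sum>l=1..min m (n-m-k). a m l * a (n-m) (k+l))"
    by (rule sum.swap)
  also have "\<dots> \<le> (\<Sum>m=1..n-1. \<Sum>(i, j)\<in>{(i, j) \<in> {1..m}\<times>{1..n-m}. i < j}. a m i * a (n-m) j)"
    using a by (intro sum_mono sum_index_diff_le) auto
  finally have "2 * ?C \<le> 2 * (\<Sum>m=1..n-1. \<Sum>(i, j)\<in>{(i, j) \<in> {1..m}\<times>{1..n-m}. i < j}. a m i * a (n-m) j)"
    by simp
  also note sum_less_pairs_le[of a, OF a assms(3)]
  also have "a 1 1 = x"
    using assms(1) by (simp add: a_def BH_coeffs_def)
  finally have C: "2 * ?C \<le> (\<Sum>m=1..n-1. t m * t (n-m)) - (if n = 2 then x\<^sup>2 else 0)"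
    unfolding t .
  show ?thesis
    using main A B C by (simp split: if_splits)
qed

section \<open>The inductive bound on the partial sums\<close>

text \<open>
  The bound \<open>11/100\<close> is stable: with \<open>x = 6/25\<close> and \<open>W = 11/100\<close> one has
  \<open>x\<^sup>2/2 + 2 (W/2 + W\<^sup>2/(4x)) W + 2 x W + W\<^sup>2 < W\<close>.
\<close>

lemma BH_majorant:
  assumes "BH_coeffs u v"
  defines "t \<equiv> row_mass u (6/25)"
  defines "Y \<equiv> \<lambda>N. \<Sum>m=1..N. (6/25) ^ m * \<bar>v m\<bar>"
  shows "(\<Sum>n=2..N. t n) \<le> 11/100" and "Y N \<le> 1"
proof -
  define x :: real where "x = 6/25"
  define W where "W N = (\<Sum>n=2..N. t n)" for N
  define s where "s n = (if n \<ge> 2 then t n else 0)" for n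
  define y where "y m = x ^ m * \<bar>v m\<bar>" for m
  have Y: "Y N = (\<Sum>m=1..N. y m)" for N
    by (simp add: Y_def y_def x_def)
  have t_nonneg: "t n \<ge> 0" for n
    by (simp add: t_def row_mass_nonneg)
  have s_nonneg: "s n \<ge> 0" and y_nonneg: "y n \<ge> 0" for n
    by (simp_all add: s_def t_nonneg y_def x_def)
  have W_nonneg: "W N \<ge> 0" and Y_nonneg: "Y N \<ge> 0" for N
    by (auto simp: W_def Y t_nonneg y_nonneg intro!: sum_nonneg)
  have sum_s: "(\<Sum>m=1..N. s m) = W N" for N
    unfolding W_def s_def by (intro sum.mono_neutral_cong_right) auto
  have sum_t: "(\<Sum>m=1..N. t m) = x + W N" if "N \<ge> 1" for N
  proof -
    have "{1..N} = insert 1 {2..N}" using that by auto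
    then show ?thesis
      using BH_row_mass_1[OF assms(1), of "6/25"] by (simp add: W_def t_def x_def)
  qed
  define C where "C n = (\<Sum>m=1..n-1. t m * t (n-m))" for n
  have conv: "(\<Sum>n=2..Suc N. C n) \<le> (x + W N)\<^sup>2" if "N \<ge> 1" for N
    using convolution_partial_sum_le[of t t N] t_nonneg that
    by (simp add: C_def sum_t[simplified] power2_eq_square)
  have delta: "(\<Sum>n=2..Suc N. if n = 2 then c else 0) = c" if "N \<ge> 1" for N and c :: real
    using that by (simp add: sum.delta)
  \<comment> \<open>The subtracted \<open>x\<^sup>2\<close> cancels the square of row 1, so the
    speeds are controlled by \<open>W\<close> alone.\<close>
  have Y_le: "4 * x * Y N \<le> 2 * x * W N + (W N)\<^sup>2" for N
  proof (cases "N \<ge> 1")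
    case True
    have "4 * x * Y N = (\<Sum>n=2..Suc N. 4 * x * y (n-1))"
      unfolding Y sum_distrib_left
      by (intro sum.reindex_bij_witness[of _ "\<lambda>n. n - 1" Suc]) auto
    also have "\<dots> \<le> (\<Sum>n=2..Suc N. C n - (if n = 2 then x\<^sup>2 else 0))"
      unfolding y_def C_def t_def x_def
      by (intro sum_mono BH_speed_le_row_mass[OF assms(1)]) auto
    also have "\<dots> \<le> (x + W N)\<^sup>2 - x\<^sup>2"
      unfolding sum_subtractf delta[OF True] using conv[OF True] by simp
    finally show ?thesis
      by (simp add: power2_eq_square algebra_simps)
  next
    case False
    then show ?thesis
      by (simp add: Y W_def)
  qed
  \<comment> \<open>The source term \<open>x\<^sup>2 / 2\<close> is the square of row 1 from the
    convolution minus the diagonal saving.\<close>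
  have W_le: "W (Suc N) \<le> x\<^sup>2 / 2 + 2 * (Y N * W N) + 2 * x * W N + (W N)\<^sup>2" if "N \<ge> 1" for N
  proof -
    have "W (Suc N) \<le> (\<Sum>n=2..Suc N. 2 * (\<Sum>m=1..n-1. y m * s (n-m)) + C n - (if n = 2 then x\<^sup>2 / 2 else 0))"
      unfolding W_def y_def C_def t_def x_def s_def
      by (intro sum_mono BH_row_mass_le[OF assms(1)]) auto
    also have "\<dots> = 2 * (\<Sum>n=2..Suc N. \<Sum>m=1..n-1. y m * s (n-m)) + (\<Sum>n=2..Suc N. C n) - x\<^sup>2 / 2"
      by (simp only: sum_subtractf sum.distrib sum_distrib_left delta[OF that])
    also have "(\<Sum>n=2..Suc N. \<Sum>m=1..n-1. y m * s (n-m)) \<le> Y N * W N"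
      using convolution_partial_sum_le[of y s N] y_nonneg s_nonneg by (simp only: Y sum_s)
    finally show ?thesis
      using conv[OF that] by (simp add: power2_eq_square algebra_simps)
  qed
  have *: "W N \<le> 11/100" for N
  proof (induction N)
    case 0
    then show ?case by (simp add: W_def)
  next
    case (Suc N)
    show ?case
    proof (cases "N \<ge> 1")
      case False
      then show ?thesis by (simp add: W_def)
    next
      case True
      have "(W N)\<^sup>2 \<le> (11/100)\<^sup>2"
        using Suc W_nonneg by (intro power_mono) auto
      then have sq: "(W N)\<^sup>2 \<le> 121/10000"
        by (simp add: power2_eq_square)
      \<comment> \<open>\<open>Y_le\<close> gives 649/9600, here rounded up. The bound
        \<open>W_le\<close> then evaluates to about 0.1086, below 0.11.\<close>
      then have "Y N \<le> 6761/100000"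
        using Y_le[of N] Suc by (simp add: x_def)
      then have "Y N * W N \<le> 6761/100000 * (11/100)"
        using Suc W_nonneg by (intro mult_mono) auto
      then show ?thesis
        using W_le[OF True] sq Suc by (simp add: x_def power2_eq_square)
    qed
  qed
  then show "(\<Sum>n=2..N. t n) \<le> 11/100" by (simp add: W_def)
  have "(W N)\<^sup>2 \<le> (11/100)\<^sup>2"
    using * W_nonneg by (intro power_mono) auto
  then show "Y N \<le> 1"
    using Y_le[of N] *[of N] by (simp add: x_def power2_eq_square)
qed

text \<open>A nonnegative term is at most any partial sum containing it. The bounds are relaxed to 1
  since only the exponential rate matters.\<close>

lemma BH_coeff_bounds:
  assumes "BH_coeffs u v"
  shows "(\<Sum>k=1..n. \<bar>u n k\<bar>) * (6/25) ^ n \<le> 1" and "\<bar>v n\<bar> * (6/25) ^ n \<le> 1"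
proof -
  have "row_mass u (6/25) n \<le> 1"
  proof (cases "n \<ge> 2")
    case True
    have "row_mass u (6/25) n \<le> (\<Sum>n=2..n. row_mass u (6/25) n)"
      using True by (intro member_le_sum row_mass_nonneg) auto
    then show ?thesis using BH_majorant(1)[OF assms, of n] by simp
  next
    case False
    then have "n = 0 \<or> n = 1" by auto
    then show ?thesis
      using BH_row_mass_1[OF assms, of "6/25"] by (auto simp: row_mass_def)
  qed
  then show "(\<Sum>k=1..n. \<bar>u n k\<bar>) * (6/25) ^ n \<le> 1"
    unfolding row_mass_def by (simp add: sum_distrib_right mult.commute)
  show "\<bar>v n\<bar> * (6/25) ^ n \<le> 1"
  proof (cases "n = 0")
    case True
    then show ?thesis using assms by (simp add: BH_coeffs_def)
  next
    case False
    have "(6/25) ^ n * \<bar>v n\<bar> \<le> (\<Sum>m=1..n. (6/25) ^ m * \<bar>v m\<bar>)"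
      using False by (intro member_le_sum) auto
    then show ?thesis using BH_majorant(2)[OF assms, of n] by (simp add: mult.commute)
  qed
qed

section \<open>An upper bound for the radius\<close>

text \<open>The defining inequality fails for every \<open>x \<ge> 6/25\<close>. Since
  \<open>GREATEST\<close> is meaningful only if a largest solution exists, existence is derived from
  compactness of a sublevel set of \<open>g\<close>, the difference of the two sides.\<close>

lemma xstar_less: "xstar < 6/25"
proof -
  define g where "g x = 8 * x + sqrt 17 * x\<^sup>2 - 4
    + 2 * sqrt ((2 * xstar_B * x\<^sup>2 + 4 * x) * (x * sqrt (x\<^sup>2 + 2.5) + 2.5 * arsinh (sqrt 0.4 * x)))"
    for x :: real
  have cont: "continuous_on A g" for A
    unfolding g_def by (intro continuous_intros) auto
  have B: "xstar_B \<ge> 3"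
  proof -
    have "pi\<^sup>2 \<ge> 3\<^sup>2"
      using pi_gt3 by (intro power_mono) auto
    then show ?thesis
      unfolding xstar_B_def by (intro real_le_rsqrt) simp
  qed
  have large: "g x > 0" if x: "x \<ge> 6/25" for x
  proof -
    have "sqrt 17 \<ge> 4"
      by (rule real_le_rsqrt) simp
    moreover have x2: "x\<^sup>2 \<ge> (6/25)\<^sup>2"
      using x by (intro power_mono) auto
    ultimately have "sqrt 17 * x\<^sup>2 \<ge> 4 * (6/25)\<^sup>2"
      by (intro mult_mono) auto
    \<comment> \<open>With 4 for \<open>sqrt 17\<close>, the value at 6/25 is -1.8496. A lower bound
      0.93 for the square root then suffices, as 2 * 0.93 = 1.86.\<close>
    then have p: "8 * x + sqrt 17 * x\<^sup>2 - 4 > - 1.85"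
      using x by (simp add: power2_eq_square)
    have "xstar_B * x\<^sup>2 \<ge> 3 * (6/25)\<^sup>2"
      using B x2 by (intro mult_mono) auto
    then have q: "2 * xstar_B * x\<^sup>2 + 4 * x \<ge> 1.3"
      using x by (simp add: power2_eq_square)
    have "sqrt (x\<^sup>2 + 2.5) \<ge> 1.58"
      by (rule real_le_rsqrt) (simp add: power2_eq_square add_increasing)
    then have "x * sqrt (x\<^sup>2 + 2.5) \<ge> (6/25) * 1.58"
      using x by (intro mult_mono) auto
    then have r1: "x * sqrt (x\<^sup>2 + 2.5) \<ge> 0.379"
      by simp
    have "sqrt 0.4 \<ge> 0.63"
      by (rule real_le_rsqrt) (simp add: power2_eq_square)
    then have "0.63 * (6/25) \<le> sqrt 0.4 * x"
      using x by (intro mult_mono) auto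
    then have z: "0.15 < sqrt 0.4 * x"
      by (rule less_le_trans[rotated]) simp
    \<comment> \<open>By monotonicity \<open>arsinh\<close> need only be bounded at
      \<open>z = 0.15\<close>, where \<open>sqrt (z\<^sup>2 + 1) \<ge> 1\<close> reduces it to
      \<open>ln (1 + z) \<ge> z - z\<^sup>2\<close>.\<close>
    have "0.1275 \<le> 0.15 - (0.15 :: real)\<^sup>2"
      by (simp add: power2_eq_square)
    also have "\<dots> \<le> ln (1 + 0.15)"
      by (rule ln_one_plus_pos_lower_bound) auto
    also have "\<dots> \<le> ln (0.15 + sqrt (0.15\<^sup>2 + 1))"
    proof -
      have "1 + 0.15 \<le> 0.15 + sqrt (0.15\<^sup>2 + 1 :: real)"
        by simp
      then show ?thesis by (intro ln_mono) auto
    qed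
    also have "\<dots> = arsinh 0.15"
      by (simp add: arsinh_real_def)
    also have "\<dots> < arsinh (sqrt 0.4 * x)"
      using z by (simp only: arsinh_less_iff_real)
    finally have r2: "arsinh (sqrt 0.4 * x) \<ge> 0.1275"
      by simp
    have "x * sqrt (x\<^sup>2 + 2.5) + 2.5 * arsinh (sqrt 0.4 * x) \<ge> 0.69"
      using r1 r2 by simp
    with q have "(2 * xstar_B * x\<^sup>2 + 4 * x) * (x * sqrt (x\<^sup>2 + 2.5) + 2.5 * arsinh (sqrt 0.4 * x))
      \<ge> 1.3 * 0.69"
      by (intro mult_mono) auto
    moreover have "1.3 * 0.69 \<ge> (0.93 :: real)\<^sup>2"
      by (simp add: power2_eq_square)
    ultimately have "sqrt ((2 * xstar_B * x\<^sup>2 + 4 * x) *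
        (x * sqrt (x\<^sup>2 + 2.5) + 2.5 * arsinh (sqrt 0.4 * x))) \<ge> 0.93"
      by (intro real_le_rsqrt) linarith
    moreover have "0 < a + 2 * b" if "a > - 1.85" "b \<ge> 0.93" for a b :: real
      using that by simp
    ultimately show ?thesis
      unfolding g_def using p by blast
  qed
  have small: "x < 6/25" if "g x \<le> 0" for x
    using large[of x] that by (meson not_le)
  \<comment> \<open>The point 0 is included for compactness. The maximum is still positive, because
    \<open>g 0 = -4\<close> yields a point \<open>w > 0\<close> of \<open>S\<close>.\<close>
  define S where "S = {0..6/25} \<inter> g -` {..0}"
  have "compact S"
    unfolding S_def by (intro compact_Int_closed closed_vimage) (auto intro: cont)
  obtain w where w: "w > 0" "g w < 0"
  proof -
    have "open (g -` {..<0})"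
      using cont[of UNIV] by (intro open_vimage) auto
    moreover have "0 \<in> g -` {..<0}"
      by (simp add: g_def)
    ultimately obtain e where "e > 0" "ball 0 e \<subseteq> g -` {..<0}"
      by (meson open_contains_ball)
    moreover from \<open>e > 0\<close> have "e / 2 \<in> ball 0 e" by simp
    ultimately have "e / 2 \<in> g -` {..<0}" by blast
    with \<open>e > 0\<close> have "e / 2 > 0" "g (e / 2) < 0" by auto
    then show ?thesis by (rule that)
  qed
  have "w \<in> S"
    using w small[of w] unfolding S_def by auto
  then obtain z where z: "z \<in> S" "\<And>y. y \<in> S \<Longrightarrow> y \<le> z"
    using compact_attains_sup[OF \<open>compact S\<close>] by blast
  have "xstar = z"
    unfolding xstar_def
  proof (rule Greatest_equality)
    have "z \<ge> w" using z \<open>w \<in> S\<close> by blast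
    then show "z > 0 \<and> 8 * z + sqrt 17 * z\<^sup>2 - 4 \<le>
       - 2 * sqrt ((2 * xstar_B * z\<^sup>2 + 4 * z) * (z * sqrt (z\<^sup>2 + 2.5) + 2.5 * arsinh (sqrt 0.4 * z)))"
      using z(1) w(1) unfolding S_def g_def by simp
  next
    fix y assume y: "y > 0 \<and> 8 * y + sqrt 17 * y\<^sup>2 - 4 \<le>
       - 2 * sqrt ((2 * xstar_B * y\<^sup>2 + 4 * y) * (y * sqrt (y\<^sup>2 + 2.5) + 2.5 * arsinh (sqrt 0.4 * y)))"
    then have "g y \<le> 0"
      by (simp add: g_def)
    then have "y \<in> S"
      using y small[of y] by (auto simp: S_def)
    then show "y \<le> z" by (rule z)
  qed
  moreover have "z < 6/25"
    using z(1) small[of z] unfolding S_def by auto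
  ultimately show ?thesis by simp
qed

section \<open>Fourier coefficients\<close>

lemma fourier_integrable:
  assumes "continuous_on UNIV f"
  shows "set_integrable lborel {0..2*pi} (\<lambda>x. complex_of_real (f x) * cis (- (real_of_int k * x)))"
  unfolding cis_conv_exp using assms
  by (intro borel_integrable_atLeastAtMost' continuous_intros) (auto intro: continuous_on_subset)

lemma fourier_coeff_add:
  assumes "continuous_on UNIV f" "continuous_on UNIV g"
  shows "fourier_coeff (\<lambda>x. f x + g x) k = fourier_coeff f k + fourier_coeff g k"
  using fourier_integrable[OF assms(1), of k] fourier_integrable[OF assms(2), of k]
  unfolding fourier_coeff_def by (simp add: distrib_right scaleR_add_right)

lemma fourier_coeff_sum:
  assumes "finite A" "\<And>n. n \<in> A \<Longrightarrow> continuous_on UNIV (g n)"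
  shows "fourier_coeff (\<lambda>x. \<Sum>n\<in>A. g n x) k = (\<Sum>n\<in>A. fourier_coeff (g n) k)"
  using assms
proof (induction A rule: finite_induct)
  case empty
  then show ?case by (simp add: fourier_coeff_def)
next
  case (insert a A)
  then show ?case
    by (simp add: fourier_coeff_add continuous_on_sum)
qed

lemma fourier_coeff_cmult: "fourier_coeff (\<lambda>x. c * f x) k = c * fourier_coeff f k"
proof -
  have "(LINT x:{0..2*pi}|lborel. complex_of_real (c * f x) * cis (- (real_of_int k * x)))
      = c * (LINT x:{0..2*pi}|lborel. complex_of_real (f x) * cis (- (real_of_int k * x)))"
    by (simp add: mult.assoc)
  then show ?thesis
    unfolding fourier_coeff_def by simp
qed

lemma norm_fourier_coeff_le:
  assumes "continuous_on UNIV f" "\<And>x. \<bar>f x\<bar> \<le> C"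
  shows "cmod (fourier_coeff f k) \<le> C"
proof -
  have "cmod (LINT x:{0..2*pi}|lborel. complex_of_real (f x) * cis (- (real_of_int k * x)))
      \<le> (LINT x:{0..2*pi}|lborel. cmod (complex_of_real (f x) * cis (- (real_of_int k * x))))"
    by (intro set_integral_norm_bound fourier_integrable assms)
  also have "\<dots> \<le> (LINT x:{0..2*pi}|lborel. C)"
    using assms
    by (intro set_integral_mono set_integrable_norm fourier_integrable borel_integrable_atLeastAtMost')
      (auto simp: norm_mult)
  also have "\<dots> = 2 * pi * C"
    by (simp add: set_lebesgue_integral_def)
  finally show ?thesis
    unfolding fourier_coeff_def by (simp add: field_simps)
qed

text \<open>The antiderivative \<open>exp (\<i> * m * x) / (\<i> * m)\<close> has period
  \<open>2 * pi\<close>, so its boundary values cancel.\<close>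

lemma set_integral_cis_eq_0:
  fixes m :: int
  assumes "m \<noteq> 0"
  shows "set_integrable lborel {0..2*pi} (\<lambda>x. cis (real_of_int m * x))"
    and "(LINT x:{0..2*pi}|lborel. cis (real_of_int m * x)) = 0"
proof -
  have cont: "continuous_on {0..2*pi} (\<lambda>x. cis (real_of_int m * x))"
    unfolding cis_conv_exp by (intro continuous_intros)
  then show "set_integrable lborel {0..2*pi} (\<lambda>x. cis (real_of_int m * x))"
    by (rule borel_integrable_atLeastAtMost')
  have deriv: "((\<lambda>x. exp (\<i> * complex_of_real (real_of_int m * x)) / (\<i> * m)) has_vector_derivative cis (real_of_int m * x)) (at x within A)"
    for x :: real and A
    using assms unfolding cis_conv_exp
    by (auto intro!: derivative_eq_intros has_vector_derivative_real_field simp: field_simps)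
  have "(LINT x:{0..2*pi}|lborel. cis (real_of_int m * x))
      = exp (\<i> * complex_of_real (m * (2*pi))) / (\<i> * m) - exp (\<i> * complex_of_real (m * 0)) / (\<i> * m)"
    using integral_FTC_atLeastAtMost[OF _ deriv cont] by (simp add: set_lebesgue_integral_def)
  also have "exp (\<i> * complex_of_real (m * (2*pi))) = 1"
    by (simp flip: cis_conv_exp) (simp add: complex_eq_iff mult.commute)
  finally show "(LINT x:{0..2*pi}|lborel. cis (real_of_int m * x)) = 0"
    by simp
qed

text \<open>The cosine is the mean of the exponentials of frequencies \<open>j\<close> and
  \<open>- j\<close>. Neither equals \<open>k\<close>, so both products integrate to 0.\<close>

lemma fourier_coeff_cos_eq_0:
  assumes "int j < \<bar>k\<bar>"
  shows "fourier_coeff (\<lambda>x. cos (real j * x)) k = 0"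
proof -
  have prod: "complex_of_real (cos (real j * x)) * cis (- (real_of_int k * x))
      = (1/2) * cis (real_of_int (int j - k) * x) + (1/2) * cis (real_of_int (- int j - k) * x)" for x
  proof -
    have "cis (real_of_int (int j - k) * x) = cis (real j * x) * cis (- (real_of_int k * x))"
      "cis (real_of_int (- int j - k) * x) = cis (- (real j * x)) * cis (- (real_of_int k * x))"
      by (simp_all add: cis_mult ring_distribs)
    moreover have "complex_of_real (cos (real j * x)) = (cis (real j * x) + cis (- (real j * x))) / 2"
      by (simp add: complex_eq_iff)
    ultimately show ?thesis by (simp only:) (simp add: field_simps)
  qed
  have "int j - k \<noteq> 0" "- int j - k \<noteq> 0"
    using assms by auto
  note int = set_integral_cis_eq_0[OF this(1)] set_integral_cis_eq_0[OF this(2)]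
  have "(LINT x:{0..2*pi}|lborel. (1/2) * cis (real_of_int (int j - k) * x) + (1/2) * cis (real_of_int (- int j - k) * x)) = 0"
    by (subst set_integral_add(2))
      (simp_all only: set_integrable_mult_right int set_integral_mult_right mult_zero_right add_0_right)
  then show ?thesis
    unfolding fourier_coeff_def prod by (simp only: scaleR_zero_right)
qed

section \<open>Weighted summability over the integers\<close>

text \<open>The integers split into the values \<open>n\<close> and \<open>- (n + 1)\<close> for
  natural \<open>n\<close>, so that 0 is counted once. By evenness the second part is the given
  series shifted by one.\<close>

lemma summable_on_int_even:
  fixes f :: "int \<Rightarrow> real"
  assumes "summable (\<lambda>n. f (int n))" "\<And>k. 0 \<le> f k" "\<And>k. f (- k) = f k"
  shows "f summable_on UNIV"
proof -
  have "(f \<circ> int) summable_on UNIV"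
    using assms(1,2) by (intro summable_nonneg_imp_summable_on) (auto simp: o_def)
  then have nonneg: "f summable_on range int"
    by (subst summable_on_reindex) auto
  have "f \<circ> (\<lambda>n. - int (Suc n)) = (\<lambda>n. f (int (Suc n)))"
    by (simp only: o_def assms(3))
  moreover have "summable (\<lambda>n. f (int (Suc n)))"
    using assms(1) summable_Suc_iff[of "\<lambda>n. f (int n)"] by blast
  ultimately have "(f \<circ> (\<lambda>n. - int (Suc n))) summable_on UNIV"
    using assms(2) by (simp only:) (rule summable_nonneg_imp_summable_on)
  then have neg: "f summable_on range (\<lambda>n. - int (Suc n))"
    by (subst summable_on_reindex) (auto simp: inj_on_def)
  have "range int \<inter> range (\<lambda>n. - int (Suc n)) = {}"
    by auto
  moreover have "range int \<union> range (\<lambda>n. - int (Suc n)) = UNIV"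
  proof (rule UNIV_eq_I[symmetric])
    show "k \<in> range int \<union> range (\<lambda>n. - int (Suc n))" for k
      by (cases k rule: int_cases) blast+
  qed
  ultimately show ?thesis
    using summable_on_Un_disjoint[OF nonneg neg] by simp
qed

text \<open>The second derivative of the geometric series has coefficients
  \<open>(n + 1) * (n + 2)\<close>, which dominate \<open>1 + n\<^sup>2\<close>.\<close>

lemma summable_on_H1_weight:
  fixes r :: real
  assumes "0 \<le> r" "r < 1"
  shows "(\<lambda>k::int. (1 + (real_of_int k)\<^sup>2) * (r ^ nat \<bar>k\<bar>)\<^sup>2) summable_on UNIV"
proof (rule summable_on_int_even)
  have "r\<^sup>2 < 1"
    using assms by (simp add: power2_less_1_iff)
  have geom: "summable (\<lambda>n. 1 * s ^ n)" if "norm s < 1" for s :: real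
    using that by (simp add: summable_geometric)
  have "summable (\<lambda>n. diffs (diffs (\<lambda>_. 1)) n * (r\<^sup>2) ^ n)"
    using \<open>r\<^sup>2 < 1\<close> by (intro termdiff_converges[of _ 1] geom) auto
  moreover have "norm ((1 + (real n)\<^sup>2) * (r\<^sup>2) ^ n) \<le> diffs (diffs (\<lambda>_. 1)) n * (r\<^sup>2) ^ n" for n
    unfolding norm_mult norm_power by (intro mult_mono) (auto simp: diffs_def power2_eq_square algebra_simps)
  ultimately have "summable (\<lambda>n. (1 + (real n)\<^sup>2) * (r\<^sup>2) ^ n)"
    by (rule summable_comparison_test'[where N = 0])
  then show "summable (\<lambda>n. (1 + (real_of_int (int n))\<^sup>2) * (r ^ nat \<bar>int n\<bar>)\<^sup>2)"
    by (simp add: power_mult[symmetric] mult.commute)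
qed auto

section \<open>Geometric trigonometric series\<close>

text \<open>For \<open>0 \<le> r < 1\<close> this is the squared H^1 norm of the Poisson kernel,
  whose Fourier coefficients are \<open>r ^ nat \<bar>k\<bar>\<close>.\<close>

definition H1_weight_sum :: "real \<Rightarrow> real" where
  "H1_weight_sum r = (\<Sum>\<^sub>\<infinity>k::int. (1 + (real_of_int k)\<^sup>2) * (r ^ nat \<bar>k\<bar>)\<^sup>2)"

text \<open>
  Since the first \<open>\<bar>k\<bar>\<close> summands do not contribute to the \<open>k\<close>-th Fourier coefficient, it
  is bounded by the supremum of the tail, so no term-by-term integration is needed.
\<close>

lemma geometric_trig_series_H1:
  fixes g :: "nat \<Rightarrow> real \<Rightarrow> real"
  assumes r: "0 \<le> r" "r < 1" and "C \<ge> 0"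
    and cont: "\<And>n. continuous_on UNIV (g n)"
    and per: "\<And>n x. g n (x + 2 * pi) = g n x"
    and bound: "\<And>n x. \<bar>g n x\<bar> \<le> C * r ^ n"
    and deg: "\<And>n k. int n < \<bar>k\<bar> \<Longrightarrow> fourier_coeff (g n) k = 0"
  defines "F \<equiv> \<lambda>x. \<Sum>n. g n x"
  shows "F \<in> H1_torus" and "H1_norm F \<le> C / (1 - r) * sqrt (H1_weight_sum r)"
proof -
  have sumC: "summable (\<lambda>n. C * r ^ (n + m))" for m
    using r by (auto intro!: summable_mult summable_mult2 summable_geometric simp: power_add)
  have summ: "summable (\<lambda>n. g (n + m) x)" for m x
    by (rule summable_comparison_test'[OF sumC[of m], of 0]) (use bound in auto)
  define T where "T m = (\<lambda>x. \<Sum>n. g (n + m) x)" for m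
  \<comment> \<open>Continuity makes the tails integrable, so that \<open>fourier_coeff\<close> is
    additive on head plus tail.\<close>
  have contT: "continuous_on UNIV (T m)" for m
  proof -
    have "uniform_limit UNIV (\<lambda>N x. \<Sum>n<N. g (n + m) x) (\<lambda>x. \<Sum>n. g (n + m) x) sequentially"
      using bound by (intro Weierstrass_m_test[OF _ sumC[of m]]) auto
    then show ?thesis
      unfolding T_def
      by (rule uniform_limit_theorem[rotated]) (auto intro!: always_eventually continuous_on_sum cont)
  qed
  have boundT: "\<bar>T m x\<bar> \<le> C / (1 - r) * r ^ m" for m x
  proof -
    have "(\<lambda>n. C * r ^ m * r ^ n) sums (C * r ^ m * (1 / (1 - r)))"
      using r by (intro sums_mult geometric_sums) auto
    then have "(\<lambda>n. C * r ^ (n + m)) sums (C / (1 - r) * r ^ m)"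
      by (simp add: power_add mult_ac)
    moreover have "norm (T m x) \<le> (\<Sum>n. C * r ^ (n + m))"
      unfolding T_def using bound by (intro norm_suminf_le sumC) auto
    ultimately show ?thesis by (simp add: sums_iff)
  qed
  have F0: "F = T 0" by (simp add: F_def T_def)
  have coeff: "cmod (fourier_coeff F k) \<le> C / (1 - r) * r ^ nat \<bar>k\<bar>" for k
  proof -
    let ?m = "nat \<bar>k\<bar>"
    have "F = (\<lambda>x. (\<Sum>n<?m. g n x) + T ?m x)"
      unfolding F_def T_def using suminf_split_initial_segment[OF summ[of 0, simplified], of _ ?m]
      by (simp add: add.commute)
    then have "fourier_coeff F k = (\<Sum>n<?m. fourier_coeff (g n) k) + fourier_coeff (T ?m) k"
      by (simp add: fourier_coeff_add fourier_coeff_sum contT cont continuous_on_sum)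
    also have "(\<Sum>n<?m. fourier_coeff (g n) k) = 0"
      by (intro sum.neutral ballI deg) auto
    finally show ?thesis
      using norm_fourier_coeff_le[OF contT boundT] by simp
  qed
  let ?w = "\<lambda>k::int. (1 + (real_of_int k)\<^sup>2) * (r ^ nat \<bar>k\<bar>)\<^sup>2"
  let ?f = "\<lambda>k. (1 + (real_of_int k)\<^sup>2) * (cmod (fourier_coeff F k))\<^sup>2"
  have le: "?f k \<le> (C / (1 - r))\<^sup>2 * ?w k" for k
  proof -
    have "?f k \<le> (1 + (real_of_int k)\<^sup>2) * (C / (1 - r) * r ^ nat \<bar>k\<bar>)\<^sup>2"
      by (intro mult_left_mono power_mono coeff) auto
    then show ?thesis unfolding power_mult_distrib by (simp only: mult_ac)
  qed
  have w: "(\<lambda>k. (C / (1 - r))\<^sup>2 * ?w k) summable_on UNIV"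
    by (intro summable_on_cmult_right summable_on_H1_weight r)
  have f: "?f summable_on UNIV"
    by (rule summable_on_comparison_test[OF w le]) auto
  have "F \<in> L2_torus"
    unfolding L2_torus_def
  proof (intro CollectI conjI allI)
    show "F (x + 2 * pi) = F x" for x
      by (simp add: F_def per)
    show "F \<in> borel_measurable borel"
      using contT[of 0] by (simp add: F0 borel_measurable_continuous_onI)
    show "set_integrable lborel {0..2*pi} (\<lambda>x. (F x)\<^sup>2)"
      unfolding F0 by (intro borel_integrable_atLeastAtMost' continuous_intros continuous_on_subset[OF contT]) auto
  qed
  with f show "F \<in> H1_torus" by (simp add: H1_torus_def)
  have "infsum ?f UNIV \<le> (\<Sum>\<^sub>\<infinity>k. (C / (1 - r))\<^sup>2 * ?w k)"
    by (intro infsum_mono f w le)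
  also have "\<dots> = (C / (1 - r))\<^sup>2 * H1_weight_sum r"
    unfolding H1_weight_sum_def by (intro infsum_cmult_right summable_on_H1_weight r)
  finally have "H1_norm F \<le> sqrt ((C / (1 - r))\<^sup>2 * H1_weight_sum r)"
    unfolding H1_norm_def by simp
  also have "\<dots> = C / (1 - r) * sqrt (H1_weight_sum r)"
    using r \<open>C \<ge> 0\<close> by (simp add: real_sqrt_mult)
  finally show "H1_norm F \<le> C / (1 - r) * sqrt (H1_weight_sum r)" .
qed

lemma H1_tendsto_Suc: "H1_tendsto F f \<Longrightarrow> H1_tendsto (\<lambda>N. F (Suc N)) f"
  unfolding H1_tendsto_def using LIMSEQ_Suc[of "\<lambda>N. H1_norm (\<lambda>x. F N x - f x)"] by blast

text \<open>The preceding estimate is applied to the head, for membership, and to the negated tail,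
  for the norm. Terms are replaced by 0 instead of shifting the index, which preserves the degree
  condition.\<close>

lemma geometric_trig_series_H1_tendsto:
  fixes g :: "nat \<Rightarrow> real \<Rightarrow> real"
  assumes r: "0 \<le> r" "r < 1" and "C \<ge> 0"
    and cont: "\<And>n. continuous_on UNIV (g n)"
    and per: "\<And>n x. g n (x + 2 * pi) = g n x"
    and bound: "\<And>n x. \<bar>g n x\<bar> \<le> C * r ^ n"
    and deg: "\<And>n k. int n < \<bar>k\<bar> \<Longrightarrow> fourier_coeff (g n) k = 0"
  shows "H1_tendsto (\<lambda>N x. \<Sum>n<N. g n x) (\<lambda>x. \<Sum>n. g n x)"
  unfolding H1_tendsto_def
proof (intro conjI allI)
  have zero: "fourier_coeff (\<lambda>x. 0) k = 0" for k
    by (simp add: fourier_coeff_def)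
  show "(\<lambda>x. \<Sum>n. g n x) \<in> H1_torus"
    by (rule geometric_trig_series_H1[OF assms])
  show "(\<lambda>x. \<Sum>n<N. g n x) \<in> H1_torus" for N
  proof -
    define h where "h n = (if n < N then g n else (\<lambda>x. 0))" for n
    have "(\<lambda>x. \<Sum>n. h n x) \<in> H1_torus"
      using assms by (intro geometric_trig_series_H1[of r C h]) (auto simp: h_def zero)
    moreover have "(\<Sum>n. h n x) = (\<Sum>n<N. g n x)" for x
      by (subst suminf_finite[of "{..<N}"]) (auto simp: h_def)
    ultimately show ?thesis by simp
  qed
  \<comment> \<open>For \<open>n \<ge> N\<close> one has
    \<open>r ^ n \<le> \<rho> ^ N * \<rho> ^ n\<close>: the first factor makes the tail small, the
    second keeps it summable.\<close>
  define \<rho> where "\<rho> = sqrt r"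
  have \<rho>: "0 \<le> \<rho>" "\<rho> < 1" "r = \<rho> * \<rho>"
    using r by (auto simp: \<rho>_def)
  have summ: "summable (\<lambda>n. g n x)" for x
    by (rule summable_comparison_test'[of "\<lambda>n. C * r ^ n" 0])
      (use r bound in \<open>auto intro!: summable_mult summable_geometric\<close>)
  have le: "H1_norm (\<lambda>x. (\<Sum>n<N. g n x) - (\<Sum>n. g n x)) \<le> C * \<rho> ^ N / (1 - \<rho>) * sqrt (H1_weight_sum \<rho>)" for N
  proof -
    define h where "h n = (if n < N then (\<lambda>x. 0) else (\<lambda>x. (-1) * g n x))" for n
    have h: "\<bar>h n x\<bar> \<le> C * \<rho> ^ N * \<rho> ^ n" for n x
    proof (cases "n < N")
      case True
      then show ?thesis using \<open>C \<ge> 0\<close> \<rho> by (simp add: h_def)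
    next
      case False
      have "\<bar>g n x\<bar> \<le> C * r ^ n" by (rule bound)
      also have "\<dots> = C * \<rho> ^ n * \<rho> ^ n"
        by (simp add: \<rho>(3) power_mult_distrib)
      also have "\<dots> \<le> C * \<rho> ^ N * \<rho> ^ n"
        using False \<rho> \<open>C \<ge> 0\<close> by (intro mult_right_mono mult_left_mono power_decreasing) auto
      finally show ?thesis using False by (simp add: h_def)
    qed
    have "H1_norm (\<lambda>x. \<Sum>n. h n x) \<le> C * \<rho> ^ N / (1 - \<rho>) * sqrt (H1_weight_sum \<rho>)"
    proof (rule geometric_trig_series_H1(2)[OF \<rho>(1,2) _ _ _ h])
      show "continuous_on UNIV (h n)" for n
        using cont by (auto simp: h_def intro!: continuous_intros)
      show "fourier_coeff (h n) k = 0" if "int n < \<bar>k\<bar>" for n k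
        using deg[OF that] fourier_coeff_cmult[of "-1" "g n" k] by (auto simp: h_def zero)
    qed (use \<open>C \<ge> 0\<close> \<rho> per in \<open>auto simp: h_def\<close>)
    moreover have "(\<Sum>n. h n x) = (\<Sum>n<N. g n x) - (\<Sum>n. g n x)" for x
    proof -
      have "(\<lambda>n. (if n < N then g n x else 0) - g n x) sums ((\<Sum>n<N. g n x) - (\<Sum>n. g n x))"
        using sums_If_finite[of "\<lambda>n. n < N" "\<lambda>n. g n x"]
        by (intro sums_diff summable_sums summ) (simp add: lessThan_def)
      then show ?thesis
        by (auto simp: h_def sums_iff if_distrib[of "\<lambda>f. f x"] cong: if_cong intro!: suminf_cong
          elim!: trans[rotated])
    qed
    ultimately show ?thesis by simp
  qed
  have "(\<lambda>N. C * \<rho> ^ N / (1 - \<rho>) * sqrt (H1_weight_sum \<rho>)) \<longlonglongrightarrow> C * 0 / (1 - \<rho>) * sqrt (H1_weight_sum \<rho>)"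
    using \<rho> by (intro tendsto_intros LIMSEQ_realpow_zero) auto
  then have lim: "(\<lambda>N. C * \<rho> ^ N / (1 - \<rho>) * sqrt (H1_weight_sum \<rho>)) \<longlonglongrightarrow> 0"
    by simp
  have nonneg: "0 \<le> H1_norm f" for f
    unfolding H1_norm_def by (simp add: infsum_nonneg)
  show "(\<lambda>N. H1_norm (\<lambda>x. (\<Sum>n<N. g n x) - (\<Sum>n. g n x))) \<longlonglongrightarrow> 0"
    by (rule tendsto_sandwich[OF _ _ tendsto_const lim]) (rule always_eventually allI nonneg le)+
qed

section \<open>Convergence of the expansion\<close>

lemma continuous_on_BH_term: "continuous_on A (BH_term u n)"
  unfolding BH_term_def by (cases "n = 1") (auto intro!: continuous_intros)

lemma BH_term_periodic: "BH_term u n (x + 2 * pi) = BH_term u n x"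
proof -
  have "cos (real k * (x + 2 * pi)) = cos (real k * x)" for k
  proof -
    have "cos (real k * (x + 2 * pi)) = cos (real k * x + 2 * real k * pi)"
      by (simp add: algebra_simps)
    also have "\<dots> = cos (real k * x)"
      by (simp add: cos_add)
    finally show ?thesis .
  qed
  then show ?thesis by (simp add: BH_term_def)
qed

lemma fourier_coeff_BH_term_eq_0:
  assumes "int n < \<bar>k\<bar>"
  shows "fourier_coeff (BH_term u n) k = 0"
proof (cases "n = 1")
  case True
  then have "BH_term u n = (\<lambda>x. cos (real n * x))"
    by (simp add: BH_term_def fun_eq_iff)
  then show ?thesis using fourier_coeff_cos_eq_0[OF assms] by simp
next
  case False
  then have "BH_term u n = (\<lambda>x. \<Sum>j=2..n. u n j * cos (real j * x))"
    by (simp add: BH_term_def fun_eq_iff)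
  then have "fourier_coeff (BH_term u n) k = (\<Sum>j=2..n. fourier_coeff (\<lambda>x. u n j * cos (real j * x)) k)"
    by (simp add: fourier_coeff_sum continuous_intros)
  also have "\<dots> = 0"
    using assms by (intro sum.neutral ballI) (simp add: fourier_coeff_cmult fourier_coeff_cos_eq_0)
  finally show ?thesis .
qed

lemma abs_BH_term_le:
  assumes "BH_coeffs u v"
  shows "\<bar>BH_term u n x\<bar> \<le> (\<Sum>k=1..n. \<bar>u n k\<bar>)"
proof (cases "n = 1")
  case True
  then show ?thesis
    using assms by (simp add: BH_term_def BH_coeffs_def)
next
  case False
  then have "\<bar>BH_term u n x\<bar> \<le> (\<Sum>k=2..n. \<bar>u n k * cos (real k * x)\<bar>)"
    unfolding BH_term_def by (simp add: sum_abs)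
  also have "\<dots> \<le> (\<Sum>k=2..n. \<bar>u n k\<bar>)"
    by (intro sum_mono) (simp add: abs_mult mult_left_le)
  also have "\<dots> \<le> (\<Sum>k=1..n. \<bar>u n k\<bar>)"
    by (intro sum_mono2) auto
  finally show ?thesis .
qed

theorem theorem3:
  fixes u :: "nat \<Rightarrow> nat \<Rightarrow> real" and v :: "nat \<Rightarrow> real" and \<epsilon> :: real
  assumes "BH_coeffs u v"
    and "\<bar>\<epsilon>\<bar> < xstar"
  shows "(\<exists>u\<^sub>\<epsilon>. H1_tendsto (\<lambda>N x. \<Sum>n=1..N. BH_term u n x * \<epsilon> ^ n) u\<^sub>\<epsilon>)
    \<and> summable (\<lambda>n. v n * \<epsilon> ^ n)"
proof
  \<comment> \<open>6/25 is the radius at which the coefficient bounds hold, and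
    \<open>xstar_less\<close> makes the ratio less than 1.\<close>
  define r where "r = \<bar>\<epsilon>\<bar> / (6/25)"
  have r: "0 \<le> r" "r < 1" and eps: "\<bar>\<epsilon>\<bar> ^ n = (6/25) ^ n * r ^ n" for n
    using assms(2) xstar_less by (simp_all add: r_def flip: power_mult_distrib)
  have scale: "c * \<bar>\<epsilon>\<bar> ^ n \<le> 1 * r ^ n" if "c * (6/25) ^ n \<le> 1" for c n
    unfolding eps mult.assoc[symmetric] using that r by (intro mult_right_mono) auto
  define g where "g n x = \<epsilon> ^ n * BH_term u n x" for n x
  have "H1_tendsto (\<lambda>N x. \<Sum>n<N. g n x) (\<lambda>x. \<Sum>n. g n x)"
  proof (rule geometric_trig_series_H1_tendsto[OF r zero_le_one])
    show "continuous_on UNIV (g n)" for n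
      unfolding g_def by (intro continuous_intros continuous_on_BH_term)
    show "g n (x + 2 * pi) = g n x" for n x
      by (simp add: g_def BH_term_periodic)
    show "\<bar>g n x\<bar> \<le> 1 * r ^ n" for n x
    proof -
      have "\<bar>g n x\<bar> \<le> (\<Sum>k=1..n. \<bar>u n k\<bar>) * \<bar>\<epsilon>\<bar> ^ n"
        unfolding g_def abs_mult power_abs mult.commute[of "\<bar>\<epsilon>\<bar> ^ n"]
        by (intro mult_right_mono abs_BH_term_le[OF assms(1)]) auto
      also have "\<dots> \<le> 1 * r ^ n"
        by (intro scale BH_coeff_bounds(1)[OF assms(1)])
      finally show ?thesis .
    qed
    show "fourier_coeff (g n) k = 0" if "int n < \<bar>k\<bar>" for n k
      unfolding g_def fourier_coeff_cmult using fourier_coeff_BH_term_eq_0[OF that] by simp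
  qed
  then have "H1_tendsto (\<lambda>N x. \<Sum>n<Suc N. g n x) (\<lambda>x. \<Sum>n. g n x)"
    by (rule H1_tendsto_Suc)
  \<comment> \<open>The summand for \<open>n = 0\<close> vanishes because \<open>BH_term u 0\<close>
    is an empty sum.\<close>
  moreover have "(\<Sum>n<Suc N. g n x) = (\<Sum>n=1..N. BH_term u n x * \<epsilon> ^ n)" for N x
    by (intro sum.mono_neutral_cong_right) (auto simp: g_def BH_term_def)
  ultimately show "\<exists>u\<^sub>\<epsilon>. H1_tendsto (\<lambda>N x. \<Sum>n=1..N. BH_term u n x * \<epsilon> ^ n) u\<^sub>\<epsilon>"
    by auto
  show "summable (\<lambda>n. v n * \<epsilon> ^ n)"
  proof (rule summable_comparison_test'[where N = 0])
    show "summable (\<lambda>n. 1 * r ^ n)"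
      using r by (simp add: summable_geometric)
    show "norm (v n * \<epsilon> ^ n) \<le> 1 * r ^ n" for n
      using scale[OF BH_coeff_bounds(2)[OF assms(1), of n]] by (simp add: abs_mult power_abs)
  qed
qed

end
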